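(* Let $\theta \in (0,1)$ and let $s_j \in (0,1]$ for each $j \in \mathbb{N}$. Then there exist a uniformly discrete unbounded set $X \subseteq \mathbb{R}^2$ and non-empty pairwise disjoint open sets $\{I_j\}_{j \in \mathbb{N}}$ in $G(2,1)$ such that, for every $j \in \mathbb{N}$, $\dim_{\mathrm{A}}^{\theta} P_V X = s_j$ for all $V \in I_j$.
   Context: A set $X \subseteq \mathbb{R}^d$ is uniformly discrete if there exists $\delta>0$ such that $|x-y| \geq \delta$ for all distinct $x,y \in X$. $G(2,1)$ is the Grassmannian of $1$-dimensional linear subspaces $V \subseteq \mathbb{R}^2$ with its usual topology (induced by the acute angle between lines). $P_V \colon \mathbb{R}^2 \to V$ is orthogonal projection onto $V$, and $V$ is identified with $\mathbb{R}$. $B(x,R)$ is the closed ball with centre $x$ and radius $R$. $N_r(A)$ is the smallest number of closed balls of radius $r>0$ needed to cover the bounded set $A$. Assouad spectrum: for $X \subseteq \mathbb{R}^m$ and $\theta \in (0,1)$, $\dim_{\mathrm{A}}^\theta X$ is the infimum of all $\alpha \geq 0$ for which there exists a constant $C>0$ such that $N_{R^{1/\theta}}(X \cap B(x,R)) \leq C (R/R^{1/\theta})^\alpha$ for all $0<R<1$ and all $x \in X$. *)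

theory Defs
  imports "HOL-Analysis.Analysis"
begin

section \<open>Covering numbers and the Assouad spectrum\<close>

definition covering_number :: "real \<Rightarrow> 'a::euclidean_space set \<Rightarrow> nat" where
  "covering_number r A =
     (LEAST n. \<exists>C. finite C \<and> card C = n \<and> A \<subseteq> (\<Union>c\<in>C. cball c r))"

text \<open>
  The set whose infimum is taken is bounded below by 0 and is never empty, because it contains the
  dimension of the ambient Euclidean space; so the real-valued infimum is meaningful.
\<close>

definition assouad_spectrum :: "real \<Rightarrow> 'a::euclidean_space set \<Rightarrow> real" where
  "assouad_spectrum \<theta> X = Inf {\<alpha>. 0 \<le> \<alpha> \<and>
     (\<exists>C>0. \<forall>R x. 0 < R \<and> R < 1 \<and> x \<in> X \<longrightarrow>
        real (covering_number (R powr (1 / \<theta>)) (X \<inter> cball x R))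
          \<le> C * (R / R powr (1 / \<theta>)) powr \<alpha>)}"

section \<open>Lines in the plane, orthogonal projections\<close>

definition lines :: "(real^2) set set" where
  "lines = {V. subspace V \<and> dim V = 1}"

definition orth_proj :: "(real^2) set \<Rightarrow> real^2 \<Rightarrow> real^2" where
  "orth_proj V x = (THE y. y \<in> V \<and> (\<forall>v\<in>V. orthogonal (x - y) v))"

text \<open>
  An identification of a line with the reals is a linear isometry of the line onto \<open>\<real>\<close>; each line
  has exactly two. Every one of them is the restriction of a linear map on the plane, and only the
  values on the line matter.
\<close>

definition line_identification :: "(real^2) set \<Rightarrow> (real^2 \<Rightarrow> real) \<Rightarrow> bool" where
  "line_identification V \<phi> \<longleftrightarrow> linear \<phi> \<and> (\<forall>v\<in>V. \<bar>\<phi> v\<bar> = norm v) \<and> \<phi> ` V = UNIV"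

text \<open>
  The acute angle is the common value of \<open>arccos \<bar>u \<bullet> w\<bar>\<close> over all choices of unit vectors. The value
  off \<open>lines\<close> is irrelevant; it is fixed because \<open>Metric_space\<close> requires a nonnegative symmetric
  function on the whole type.
\<close>

definition acute_angle :: "(real^2) set \<Rightarrow> (real^2) set \<Rightarrow> real" where
  "acute_angle V W = (if V \<in> lines \<and> W \<in> lines
     then (THE a. \<exists>u\<in>V. \<exists>w\<in>W. norm u = 1 \<and> norm w = 1 \<and> a = arccos \<bar>u \<bullet> w\<bar>)
     else 0)"

definition line_topology :: "(real^2) set topology" where
  "line_topology = Metric_space.mtopology lines acute_angle"

section \<open>Well-definedness\<close>

lemma orth_proj_eqI:
  assumes "subspace V" "y \<in> V" "\<And>v. v \<in> V \<Longrightarrow> orthogonal (x - y) v"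
  shows "orth_proj V x = y"
  unfolding orth_proj_def
proof (rule the_equality)
  show "y \<in> V \<and> (\<forall>v\<in>V. orthogonal (x - y) v)" using assms by blast
next
  fix z assume z: "z \<in> V \<and> (\<forall>v\<in>V. orthogonal (x - z) v)"
  have "z - y \<in> V" using assms z by (simp add: subspace_diff)
  then have "(x - y) \<bullet> (z - y) = 0" "(x - z) \<bullet> (z - y) = 0"
    using assms z by (auto simp: orthogonal_def)
  then have "(z - y) \<bullet> (z - y) = 0" by (simp add: inner_diff_left)
  then show "z = y" by simp
qed

lemma orth_proj:
  assumes "subspace V"
  shows "orth_proj V x \<in> V" "\<And>v. v \<in> V \<Longrightarrow> orthogonal (x - orth_proj V x) v"
proof -
  obtain y z where yz: "y \<in> span V" "\<And>w. w \<in> span V \<Longrightarrow> orthogonal z w" "x = y + z"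
    using orthogonal_subspace_decomp_exists[of V x] by metis
  have sp: "span V = V" using assms by (simp add: span_eq_iff)
  have "orth_proj V x = y"
    using yz sp assms by (intro orth_proj_eqI) auto
  then show "orth_proj V x \<in> V" "\<And>v. v \<in> V \<Longrightarrow> orthogonal (x - orth_proj V x) v"
    using yz sp by auto
qed

lemma lines_unit:
  assumes "V \<in> lines"
  obtains u where "u \<in> V" "norm u = 1" "V = span {u}"
proof -
  have V: "subspace V" "dim V = 1" using assms by (auto simp: lines_def)
  obtain B where B: "B \<subseteq> V" "independent B" "V \<subseteq> span B" "card B = dim V"
    using basis_exists[of V] by metis
  then obtain b where b: "B = {b}" using V by (metis card_1_singletonE)
  then have b0: "b \<noteq> 0" using B dependent_zero by auto
  define u where "u = b /\<^sub>R norm b"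
  have "b \<in> V" using B b by auto
  then have "u \<in> V" using V by (simp add: u_def subspace_scale)
  have "norm u = 1" using b0 by (simp add: u_def)
  have "b = norm b *\<^sub>R u" using b0 by (simp add: u_def)
  then have "b \<in> span {u}" by (metis span_base span_scale insertI1)
  then have "span B \<subseteq> span {u}" unfolding b by (simp add: span_minimal)
  then have "V = span {u}"
    using B(3) span_minimal[of "{u}" V] \<open>u \<in> V\<close> V(1) by auto
  with \<open>u \<in> V\<close> \<open>norm u = 1\<close> show thesis using that by blast
qed

lemma line_unit_cases:
  assumes "V \<in> lines" "u \<in> V" "norm u = 1" "v \<in> V" "norm v = 1"
  shows "v = u \<or> v = - u"
proof -
  obtain e where e: "norm e = 1" "V = span {e}" using lines_unit assms(1) by metis
  obtain a b where ab: "u = a *\<^sub>R e" "v = b *\<^sub>R e"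
    using assms e by (auto simp: span_singleton)
  then have "\<bar>a\<bar> = 1" "\<bar>b\<bar> = 1" using assms e by auto
  then show ?thesis unfolding ab by (auto simp: abs_if split: if_splits)
qed

lemma acute_angle_eq:
  assumes "V \<in> lines" "W \<in> lines" "u \<in> V" "norm u = 1" "w \<in> W" "norm w = 1"
  shows "acute_angle V W = arccos \<bar>u \<bullet> w\<bar>"
proof -
  have "(THE a. \<exists>u\<in>V. \<exists>w\<in>W. norm u = 1 \<and> norm w = 1 \<and> a = arccos \<bar>u \<bullet> w\<bar>) = arccos \<bar>u \<bullet> w\<bar>"
  proof (rule the_equality)
    fix a assume "\<exists>u\<in>V. \<exists>w\<in>W. norm u = 1 \<and> norm w = 1 \<and> a = arccos \<bar>u \<bullet> w\<bar>"
    then obtain u' w' where *: "u' \<in> V" "w' \<in> W" "norm u' = 1" "norm w' = 1"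
      and a: "a = arccos \<bar>u' \<bullet> w'\<bar>" by blast
    have "u' = u \<or> u' = - u" "w' = w \<or> w' = - w"
      using line_unit_cases assms * by blast+
    then show "a = arccos \<bar>u \<bullet> w\<bar>" unfolding a by auto
  qed (use assms in blast)
  then show ?thesis using assms by (simp add: acute_angle_def)
qed

lemma abs_inner_unit_le: "norm u = 1 \<Longrightarrow> norm w = 1 \<Longrightarrow> \<bar>u \<bullet> w\<bar> \<le> 1"
  using Cauchy_Schwarz_ineq2[of u w] by simp

lemma arccos_inner_triangle:
  fixes u v w :: "'a::real_inner"
  assumes "norm u = 1" "norm v = 1" "norm w = 1"
  shows "arccos (u \<bullet> w) \<le> arccos (u \<bullet> v) + arccos (v \<bullet> w)"
proof -
  define p q where "p = u \<bullet> v" and "q = v \<bullet> w"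
  have bd: "\<bar>u \<bullet> w\<bar> \<le> 1" "\<bar>p\<bar> \<le> 1" "\<bar>q\<bar> \<le> 1"
    using assms by (auto simp: p_def q_def intro!: abs_inner_unit_le)
  have one: "u \<bullet> u = 1" "v \<bullet> v = 1" "w \<bullet> w = 1"
    using assms by (simp_all add: norm_eq_1)
  define x y where "x = u - p *\<^sub>R v" and "y = w - q *\<^sub>R v"
  have xx: "x \<bullet> x = 1 - p\<^sup>2" and yy: "y \<bullet> y = 1 - q\<^sup>2" and xy: "x \<bullet> y = u \<bullet> w - p * q"
    using one by (auto simp: x_def y_def p_def q_def inner_diff_left inner_diff_right
        power2_eq_square inner_commute)
  have "\<bar>x \<bullet> y\<bar> \<le> norm x * norm y" by (rule Cauchy_Schwarz_ineq2)
  then have "u \<bullet> w \<ge> p * q - sqrt (1 - p\<^sup>2) * sqrt (1 - q\<^sup>2)"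
    unfolding norm_eq_sqrt_inner xx yy xy by linarith
  also have "p * q - sqrt (1 - p\<^sup>2) * sqrt (1 - q\<^sup>2) = cos (arccos p + arccos q)"
    using bd by (simp add: cos_add cos_arccos_abs sin_arccos_abs)
  finally have le: "cos (arccos p + arccos q) \<le> u \<bullet> w" .
  have nn: "0 \<le> arccos p" "0 \<le> arccos q"
    using bd by (auto intro!: arccos_lbound)
  show ?thesis
  proof (cases "arccos p + arccos q \<le> pi")
    case True
    have "arccos (u \<bullet> w) \<le> arccos (cos (arccos p + arccos q))"
      using le bd by (intro arccos_le_arccos) (auto)
    also have "\<dots> = arccos p + arccos q" using True nn by (intro arccos_cos) auto
    finally show ?thesis by (simp add: p_def q_def)
  next
    case False
    have "arccos (u \<bullet> w) \<le> pi" using bd by (intro arccos_ubound) auto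
    then show ?thesis using False by (simp add: p_def q_def)
  qed
qed

lemma Metric_space_lines: "Metric_space lines acute_angle"
proof
  show nn: "0 \<le> acute_angle V W" for V W
  proof (cases "V \<in> lines \<and> W \<in> lines")
    case True
    obtain u where u: "u \<in> V" "norm u = 1" using True lines_unit by metis
    obtain w where w: "w \<in> W" "norm w = 1" using True lines_unit by metis
    have "\<bar>u \<bullet> w\<bar> \<le> 1" using u w abs_inner_unit_le by blast
    then show ?thesis using True u w by (auto simp: acute_angle_eq intro!: arccos_lbound)
  qed (auto simp: acute_angle_def)
  show "acute_angle V W = acute_angle W V" for V W
  proof (cases "V \<in> lines \<and> W \<in> lines")
    case True
    obtain u where u: "u \<in> V" "norm u = 1" using True lines_unit by metis
    obtain w where w: "w \<in> W" "norm w = 1" using True lines_unit by metis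
    show ?thesis using True u w by (simp add: acute_angle_eq inner_commute)
  qed (auto simp: acute_angle_def)
  show "acute_angle V W = 0 \<longleftrightarrow> V = W" if VW: "V \<in> lines" "W \<in> lines" for V W
  proof -
    obtain u where u: "u \<in> V" "norm u = 1" "V = span {u}" using VW lines_unit by metis
    obtain w where w: "w \<in> W" "norm w = 1" "W = span {w}" using VW lines_unit by metis
    have eq: "acute_angle V W = arccos \<bar>u \<bullet> w\<bar>" using VW u w by (simp add: acute_angle_eq)
    show ?thesis
    proof
      assume "acute_angle V W = 0"
      then have "\<bar>u \<bullet> w\<bar> = 1"
        using eq abs_inner_unit_le[of u w] u w by (metis cos_arccos_abs cos_zero abs_idempotent)
      then have "(u - w) \<bullet> (u - w) = 0 \<or> (u + w) \<bullet> (u + w) = 0"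
        using u w by (auto simp: inner_diff_left inner_diff_right inner_add_left inner_add_right
            inner_commute norm_eq_1 abs_if split: if_splits)
      then have "u = w \<or> u = - w" by (auto simp: eq_neg_iff_add_eq_0)
      moreover have "span {- w} = span {w}"
        unfolding span_singleton
      proof (intro equalityI subsetI; elim rangeE)
        fix x k assume "x = k *\<^sub>R - w"
        then have "x = (- k) *\<^sub>R w" by simp
        then show "x \<in> range (\<lambda>k. k *\<^sub>R w)" by blast
      next
        fix x k assume "x = k *\<^sub>R w"
        then have "x = (- k) *\<^sub>R - w" by simp
        then show "x \<in> range (\<lambda>k. k *\<^sub>R - w)" by blast
      qed
      ultimately show "V = W" using u w by auto
    next
      assume "V = W"
      then have "acute_angle V W = arccos \<bar>u \<bullet> u\<bar>" using VW u by (simp add: acute_angle_eq)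
      then show "acute_angle V W = 0" using u by (simp add: norm_eq_1)
    qed
  qed
  show "acute_angle U W \<le> acute_angle U V + acute_angle V W"
    if UVW: "U \<in> lines" "V \<in> lines" "W \<in> lines" for U V W
  proof -
    obtain v where v: "v \<in> V" "norm v = 1" using UVW lines_unit by metis
    obtain u0 where u0: "u0 \<in> U" "norm u0 = 1" using UVW lines_unit by metis
    obtain w0 where w0: "w0 \<in> W" "norm w0 = 1" using UVW lines_unit by metis
    have sub: "subspace U" "subspace W" using UVW by (auto simp: lines_def)
    define u where "u = (if u0 \<bullet> v \<ge> 0 then u0 else - u0)"
    define w where "w = (if v \<bullet> w0 \<ge> 0 then w0 else - w0)"
    have u: "u \<in> U" "norm u = 1" "\<bar>u \<bullet> v\<bar> = u \<bullet> v"
      using u0 sub by (auto simp: u_def subspace_neg)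
    have w: "w \<in> W" "norm w = 1" "\<bar>v \<bullet> w\<bar> = v \<bullet> w"
      using w0 sub by (auto simp: w_def subspace_neg)
    have b: "\<bar>u \<bullet> w\<bar> \<le> 1" using u w abs_inner_unit_le by blast
    have "acute_angle U W = arccos \<bar>u \<bullet> w\<bar>" using UVW u w by (simp add: acute_angle_eq)
    also have "\<dots> \<le> arccos (u \<bullet> w)" using b by (intro arccos_le_arccos) auto
    also have "\<dots> \<le> arccos (u \<bullet> v) + arccos (v \<bullet> w)"
      using u v w by (intro arccos_inner_triangle) auto
    also have "\<dots> = acute_angle U V + acute_angle V W"
      using UVW u v w by (simp add: acute_angle_eq)
    finally show ?thesis .
  qed
qed

end

theory Submission
  imports Defs
begin

text \<open>
  Parametrise lines by their slope \<open>t\<close>. Up to a bounded factor the projection of \<open>(x, y)\<close> to the line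
  of slope \<open>t\<close> is \<open>x + t y\<close>, so the point \<open>(c + g i - \<tau> M\<^sup>i, M\<^sup>i)\<close> is sent to
  \<open>c + g i + (t - \<tau>) M\<^sup>i\<close>. A patch consists of the points with \<open>i < K\<close>. If \<open>t\<close> is very close to \<open>\<tau>\<close>,
  its projection is essentially an arithmetic progression of \<open>K\<close> points with gap \<open>g\<close>. For every
  other \<open>t\<close>, since the heights \<open>M\<^sup>i\<close> are lacunary, an initial part of the patch still looks like this
  progression, the remaining points are far apart, and at most one point is in between: turning the
  line away from \<open>\<tau>\<close> never creates a denser cluster.

  For the target value \<open>s\<close> take \<open>K = g\<^sup>-\<^sup>s\<^sup>(\<^sup>1\<^sup>-\<^sup>\<theta>\<^sup>)\<close>. With \<open>R = g\<^sup>\<theta>\<close> and \<open>r = R\<^sup>1\<^sup>/\<^sup>\<theta> = g\<close> the whole patch lies in a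
  ball of radius \<open>R\<close> and needs about \<open>K = (R/r)\<^sup>s\<close> balls of radius \<open>r\<close>, and this is the worst scale.
  The slopes \<open>\<tau>\<close> of the patches assigned to \<open>s\<^sub>j\<close> run through a dense sequence in an interval \<open>J\<^sub>j\<close>, so every
  \<open>t \<in> J\<^sub>j\<close> meets arbitrarily large patches almost exactly. If \<open>t \<in> J\<^sub>k\<close> with \<open>k \<noteq> j\<close>, then \<open>\<bar>t - \<tau>\<bar>\<close> is
  bounded below, and as \<open>K \<le> M\<close> either all but one of the points are far apart or the patch has
  boundedly many points. Placing the patches far apart along the first axis makes every ball of
  radius less than 1 see only one of them.
\<close>

section \<open>Covering numbers\<close>

lemma covering_number_le:
  assumes "finite C" "A \<subseteq> (\<Union>c\<in>C. cball c r)"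
  shows "covering_number r A \<le> card C"
  unfolding covering_number_def by (rule Least_le) (use assms in auto)

text \<open>This turns the \<open>LEAST\<close> into an attained minimum: a finite cover exists
  because the compact closure of a bounded set is totally bounded.\<close>

lemma covering_number_cover:
  fixes A :: "'a::euclidean_space set"
  assumes "bounded A" "0 < r"
  obtains C where "finite C" "card C = covering_number r A" "A \<subseteq> (\<Union>c\<in>C. cball c r)"
proof -
  have "compact (closure A)" using assms(1) by simp
  then obtain D where D: "finite D" "closure A \<subseteq> (\<Union>c\<in>D. ball c r)"
    using assms(2) unfolding compact_eq_totally_bounded by blast
  then have "A \<subseteq> (\<Union>c\<in>D. cball c r)"
    using closure_subset[of A] by (force simp: subset_iff)
  with D(1) have "\<exists>n C. finite C \<and> card C = n \<and> A \<subseteq> (\<Union>c\<in>C. cball c r)" by blast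
  from LeastI_ex[OF this] obtain C where
    "finite C" "card C = covering_number r A" "A \<subseteq> (\<Union>c\<in>C. cball c r)"
    unfolding covering_number_def by (elim exE conjE)
  then show thesis by (rule that)
qed

lemma covering_number_mono:
  fixes A B :: "'a::euclidean_space set"
  assumes "A \<subseteq> B" "bounded B" "0 < r"
  shows "covering_number r A \<le> covering_number r B"
proof -
  obtain C where "finite C" "card C = covering_number r B" "B \<subseteq> (\<Union>c\<in>C. cball c r)"
    using covering_number_cover[OF assms(2,3)] .
  then show ?thesis using covering_number_le[of C A r] assms(1) by (metis subset_trans)
qed

lemma covering_number_Un_le:
  fixes A B :: "'a::euclidean_space set"
  assumes "bounded A" "bounded B" "0 < r"
  shows "covering_number r (A \<union> B) \<le> covering_number r A + covering_number r B"
proof -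
  obtain C where C: "finite C" "card C = covering_number r A" "A \<subseteq> (\<Union>c\<in>C. cball c r)"
    using covering_number_cover[OF assms(1,3)] .
  obtain D where D: "finite D" "card D = covering_number r B" "B \<subseteq> (\<Union>c\<in>D. cball c r)"
    using covering_number_cover[OF assms(2,3)] .
  have "covering_number r (A \<union> B) \<le> card (C \<union> D)"
    using C(1,3) D(1,3) by (intro covering_number_le) blast+
  also have "\<dots> \<le> card C + card D" by (rule card_Un_le)
  finally show ?thesis using C D by simp
qed

lemma covering_number_le_card:
  assumes "finite A" "0 \<le> r"
  shows "covering_number r A \<le> card A"
  using assms by (intro covering_number_le) auto

text \<open>Centres are laid from the left end point at spacing \<open>r\<close>, and only the right
  half of each ball is used. This costs a factor of about 2 but makes the index of a suitable centre
  a plain floor.\<close>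

lemma covering_number_cball_real_le:
  fixes a :: real
  assumes "0 < r" "0 \<le> l"
  shows "real (covering_number r (cball a l)) \<le> 2 * l / r + 1"
proof -
  define N where "N = nat \<lfloor>2 * l / r\<rfloor>"
  define f where "f k = a - l + real k * r" for k
  have "cball a l \<subseteq> (\<Union>c\<in>f ` {..N}. cball c r)"
  proof
    fix x assume "x \<in> cball a l"
    then have x: "a - l \<le> x" "x \<le> a + l" by (auto simp: dist_real_def)
    define k where "k = nat \<lfloor>(x - (a - l)) / r\<rfloor>"
    have nn: "0 \<le> (x - (a - l)) / r" using x assms by simp
    have "(x - (a - l)) / r \<le> 2 * l / r"
      using x assms by (intro divide_right_mono) auto
    then have "k \<le> N" unfolding k_def N_def by (intro nat_mono floor_mono)
    moreover have "real k \<le> (x - (a - l)) / r" "(x - (a - l)) / r < real k + 1"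
      using nn unfolding k_def by linarith+
    then have "real k * r \<le> x - (a - l)" "x - (a - l) < (real k + 1) * r"
      using assms by (auto simp: field_simps)
    then have "x \<in> cball (f k) r" unfolding f_def by (auto simp: dist_real_def algebra_simps abs_if)
    ultimately show "x \<in> (\<Union>c\<in>f ` {..N}. cball c r)" by blast
  qed
  then have "covering_number r (cball a l) \<le> card (f ` {..N})"
    by (intro covering_number_le) auto
  also have "\<dots> \<le> N + 1" using card_image_le[of "{..N}" f] by simp
  finally have "real (covering_number r (cball a l)) \<le> real N + 1" by linarith
  also have "real N \<le> 2 * l / r" using assms unfolding N_def by (simp add: of_nat_nat)
  finally show ?thesis by simp
qed

text \<open>Two points of one closed ball of radius \<open>r\<close> are at most
  \<open>2 * r\<close> apart, so choosing a covering ball for each point of \<open>S\<close> is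
  injective.\<close>

lemma card_separated_le_covering_number:
  fixes A :: "'a::euclidean_space set"
  assumes "bounded A" "0 < r" "S \<subseteq> A"
    and sep: "\<And>x y. x \<in> S \<Longrightarrow> y \<in> S \<Longrightarrow> x \<noteq> y \<Longrightarrow> 2 * r < dist x y"
  shows "card S \<le> covering_number r A"
proof -
  obtain C where C: "finite C" "card C = covering_number r A" "A \<subseteq> (\<Union>c\<in>C. cball c r)"
    using covering_number_cover[OF assms(1,2)] .
  have "\<exists>c\<in>C. dist c x \<le> r" if "x \<in> S" for x
    using subsetD[OF C(3) subsetD[OF assms(3) that]] by simp
  then obtain f where f: "\<And>x. x \<in> S \<Longrightarrow> f x \<in> C \<and> dist (f x) x \<le> r" by metis
  have "inj_on f S"
  proof (rule inj_onI, rule ccontr)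
    fix x y assume *: "x \<in> S" "y \<in> S" "f x = f y" "x \<noteq> y"
    have "dist x y \<le> dist (f x) x + dist (f x) y" by (rule dist_triangle3)
    also have "\<dots> \<le> r + r"
      using f[OF *(1)] f[OF *(2)] by (intro add_mono) (simp_all only: *(3))
    finally show False using sep[OF *(1,2,4)] by simp
  qed
  moreover have "f ` S \<subseteq> C" using f by blast
  ultimately have "card S \<le> card C" using C(1) by (rule card_inj_on_le)
  then show ?thesis using C(2) by simp
qed

section \<open>Lines of given slope\<close>

text \<open>The direction vector is left unnormalised, so that projecting \<open>x\<close> gives
  \<open>x $ 1 + t * x $ 2\<close> up to one scalar.\<close>

definition slope_line :: "real \<Rightarrow> (real^2) set" where
  "slope_line t = span {vector [1, t]}"

lemma inner_vector_2: "(x::real^2) \<bullet> y = x $ 1 * y $ 1 + x $ 2 * y $ 2"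
  by (simp add: inner_vec_def sum_2)

lemma slope_line_in_lines: "slope_line t \<in> lines"
proof -
  have "(vector [1, t] :: real^2) $ 1 \<noteq> 0" by simp
  then have "(vector [1, t] :: real^2) \<noteq> 0" by (metis zero_index)
  then show ?thesis by (simp add: lines_def slope_line_def dim_span)
qed

lemma slope_line_inj: "slope_line t = slope_line t' \<Longrightarrow> t = t'"
proof -
  assume "slope_line t = slope_line t'"
  then have "(vector [1, t] :: real^2) \<in> span {vector [1, t']}"
    unfolding slope_line_def by (metis insertI1 span_base)
  then obtain k where "(vector [1, t] :: real^2) = k *\<^sub>R vector [1, t']"
    by (auto simp: span_singleton)
  then show "t = t'" by (simp add: vec_eq_iff forall_2)
qed

text \<open>With \<open>v\<close> the direction vector, the scalar is
  \<open>\<phi> v / (v \<bullet> v)\<close>. Its modulus is \<open>1 / norm v\<close> with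
  \<open>norm v\<close> between 1 and 2; its sign depends on the identification, so only the modulus
  is controlled.\<close>

lemma line_identification_slope_line:
  assumes "line_identification (slope_line t) \<phi>" "0 \<le> t" "t \<le> 1"
  obtains \<mu> where "1/2 \<le> \<bar>\<mu>\<bar>" "\<bar>\<mu>\<bar> \<le> 1"
    "\<And>x. \<phi> (orth_proj (slope_line t) x) = \<mu> * (x $ 1 + t * x $ 2)"
proof -
  define v :: "real^2" where "v = vector [1, t]"
  have vv: "v \<bullet> v = 1 + t^2" by (simp add: v_def inner_vector_2 power2_eq_square)
  have pos: "0 < v \<bullet> v" unfolding vv by (simp add: add_pos_nonneg)
  have vV: "v \<in> slope_line t" unfolding slope_line_def v_def by (simp add: span_base)
  have \<phi>v: "\<bar>\<phi> v\<bar> = norm v" and lin: "linear \<phi>"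
    using assms(1) vV by (auto simp: line_identification_def)
  define \<mu> where "\<mu> = \<phi> v / (v \<bullet> v)"
  have nv: "0 < norm v" "v \<bullet> v = norm v * norm v"
    using pos by (auto simp: dot_square_norm power2_eq_square)
  have "\<bar>\<mu>\<bar> = 1 / norm v" unfolding \<mu>_def using nv \<phi>v by (simp add: abs_mult)
  moreover have "norm v \<ge> 1" "norm v \<le> 2"
  proof -
    have "t^2 \<le> 1" using assms by (simp add: power_le_one)
    then have "1 \<le> (norm v)^2" "(norm v)^2 \<le> 2^2" using vv by (auto simp: dot_square_norm)
    then show "norm v \<ge> 1" "norm v \<le> 2"
      using power2_le_imp_le[of 1 "norm v"] power2_le_imp_le[of "norm v" 2] by simp_all
  qed
  moreover have "\<phi> (orth_proj (slope_line t) x) = \<mu> * (x $ 1 + t * x $ 2)" for x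
  proof -
    have "orth_proj (slope_line t) x = ((x \<bullet> v) / (v \<bullet> v)) *\<^sub>R v"
    proof (rule orth_proj_eqI)
      show "subspace (slope_line t)" by (simp add: slope_line_def)
      show "((x \<bullet> v) / (v \<bullet> v)) *\<^sub>R v \<in> slope_line t"
        using vV by (simp add: slope_line_def span_scale)
      fix w assume "w \<in> slope_line t"
      then obtain k where "w = k *\<^sub>R v" by (auto simp: slope_line_def v_def span_singleton)
      then show "orthogonal (x - ((x \<bullet> v) / (v \<bullet> v)) *\<^sub>R v) w"
        using pos by (simp add: orthogonal_def inner_diff_left)
    qed
    then have "\<phi> (orth_proj (slope_line t) x) = (x \<bullet> v) / (v \<bullet> v) * \<phi> v"
      using lin by (simp add: linear_cmul)
    also have "x \<bullet> v = x $ 1 + t * x $ 2" by (simp add: v_def inner_vector_2)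
    finally show ?thesis by (simp add: \<mu>_def)
  qed
  moreover have "1/2 \<le> \<bar>\<mu>\<bar>" "\<bar>\<mu>\<bar> \<le> 1"
    using calculation(1-3) frac_le[of 1 1 "norm v" 2] frac_le[of 1 1 1 "norm v"] by (linarith | simp)+
  ultimately show thesis by (intro that[of \<mu>])
qed

text \<open>This lets a metric ball of lines be chosen inside a prescribed interval of slopes. For a
  unit vector (a, b) on a nearby line, the defect \<open>b - t0 * a\<close> is small by Lagrange's
  identity and \<open>a\<close> stays away from 0, so \<open>b / a\<close> is close to
  \<open>t0\<close>.\<close>

lemma lines_near_slope_line:
  assumes "\<bar>t0\<bar> \<le> 1" "0 < \<eta>"
  obtains \<rho> where "0 < \<rho>"
    "\<And>W. W \<in> lines \<Longrightarrow> acute_angle (slope_line t0) W < \<rho> \<Longrightarrow> \<exists>t. \<bar>t - t0\<bar> < \<eta> \<and> W = slope_line t"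
proof -
  define \<kappa> where "\<kappa> = min (1/4) (\<eta>/2)"
  have \<kappa>: "0 < \<kappa>" "\<kappa> \<le> 1/4" "2 * \<kappa> \<le> \<eta>" using assms by (auto simp: \<kappa>_def)
  have \<kappa>2: "\<kappa>^2 \<le> 1" using \<kappa> by (intro power_le_one) auto
  \<comment> \<open>An angle below \<open>arccos c\<close> has squared sine below
    \<open>\<kappa>^2 / 2\<close>; the half absorbs the factor \<open>1 + t0^2\<close>, which is at
    most 2.\<close>
  define c where "c = sqrt (1 - \<kappa>^2 / 2)"
  have c2: "c^2 = 1 - \<kappa>^2 / 2" unfolding c_def using \<kappa>2 by simp
  have c: "0 \<le> c" "c < 1" unfolding c_def using \<kappa>2 \<kappa> by auto
  define v :: "real^2" where "v = vector [1, t0]"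
  have vv: "v \<bullet> v = 1 + t0^2" by (simp add: v_def inner_vector_2 power2_eq_square)
  have pos: "0 < v \<bullet> v" unfolding vv by (simp add: add_pos_nonneg)
  then have v0: "norm v > 0" by auto
  define u where "u = v /\<^sub>R norm v"
  have u: "u \<in> slope_line t0" "norm u = 1"
    using v0 by (auto simp: u_def slope_line_def v_def span_scale span_base)
  show thesis
  proof (rule that[of "arccos c"])
    show "0 < arccos c" using arccos_less_arccos[of c 1] c by simp
    fix W assume W: "W \<in> lines" "acute_angle (slope_line t0) W < arccos c"
    obtain w where w: "w \<in> W" "norm w = 1" "W = span {w}" using lines_unit[OF W(1)] by metis
    have "arccos \<bar>u \<bullet> w\<bar> < arccos c"
      using W(2) acute_angle_eq[OF slope_line_in_lines W(1) u w(1,2)] by simp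
    then have "c < \<bar>u \<bullet> w\<bar>"
      using arccos_le_arccos[of "\<bar>u \<bullet> w\<bar>" c] c by linarith
    then have "c^2 < (u \<bullet> w)^2" using c power_strict_mono[of c "\<bar>u \<bullet> w\<bar>" 2] by simp
    moreover have "(u \<bullet> w)^2 = (v \<bullet> w)^2 / (v \<bullet> v)"
      by (simp add: u_def dot_square_norm power_mult_distrib divide_inverse power_inverse mult.commute)
    ultimately have "1 - \<kappa>^2/2 < (v \<bullet> w)^2 / (v \<bullet> v)" using c2 by simp
    then have *: "(1 - \<kappa>^2/2) * (1 + t0^2) < (v \<bullet> w)^2" using pos vv by (simp add: field_simps)
    define a b where "a = w $ 1" and "b = w $ 2"
    have ab: "a^2 + b^2 = 1" using w(2) by (simp add: a_def b_def norm_eq_1 inner_vector_2 power2_eq_square)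
    have vw: "v \<bullet> w = a + t0 * b" by (simp add: v_def inner_vector_2 a_def b_def)
    have lag: "(a + t0 * b)^2 + (b - t0 * a)^2 = (1 + t0^2)"
    proof -
      have "(a + t0 * b)^2 + (b - t0 * a)^2 = (1 + t0^2) * (a^2 + b^2)" by algebra
      then show ?thesis using ab by simp
    qed
    have "t0^2 \<le> 1" using assms(1) by (simp add: abs_square_le_1)
    then have "\<kappa>^2/2 * (1 + t0^2) \<le> \<kappa>^2/2 * 2" by (intro mult_left_mono) auto
    then have "(b - t0 * a)^2 < \<kappa>^2" using *[unfolded left_diff_distrib] lag vw by simp
    then have bk: "\<bar>b - t0 * a\<bar> < \<kappa>" using \<kappa> using power2_less_imp_less[of "\<bar>b - t0 * a\<bar>" \<kappa>] by simp
    have a: "\<bar>a\<bar> \<ge> 1/2"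
    proof (rule ccontr)
      assume "\<not> \<bar>a\<bar> \<ge> 1/2"
      then have a1: "\<bar>a\<bar> < 1/2" by simp
      have "\<bar>t0 * a\<bar> \<le> 1 * \<bar>a\<bar>" unfolding abs_mult using assms(1) by (intro mult_right_mono) auto
      then have b1: "\<bar>b\<bar> \<le> 3/4" using bk \<kappa> a1 by linarith
      have "\<bar>a\<bar>^2 \<le> (1/2)^2" "\<bar>b\<bar>^2 \<le> (3/4)^2" using a1 b1 by (intro power_mono; simp)+
      then show False using ab by (simp add: power2_eq_square)
    qed
    then have a0: "a \<noteq> 0" by auto
    define t where "t = b / a"
    have "\<bar>t - t0\<bar> = \<bar>b - t0 * a\<bar> / \<bar>a\<bar>" using a0 by (simp add: t_def field_simps flip: abs_divide)
    also have "\<dots> < \<kappa> / \<bar>a\<bar>" using bk a0 by (intro divide_strict_right_mono) auto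
    also have "\<dots> \<le> \<kappa> / (1/2)" using a \<kappa> by (intro divide_left_mono) auto
    finally have "\<bar>t - t0\<bar> < \<eta>" using \<kappa> by simp
    moreover have "W = slope_line t"
    proof -
      have wv: "w = a *\<^sub>R vector [1, t]" using a0
        by (simp add: vec_eq_iff forall_2 t_def a_def b_def)
      have "span {a *\<^sub>R (vector [1, t] :: real^2)} = span {vector [1, t]}"
        using span_image_scale[of "{vector [1, t] :: real^2}" "\<lambda>_. a"] a0 by simp
      then show ?thesis unfolding w(3) slope_line_def wv .
    qed
    ultimately show "\<exists>t. \<bar>t - t0\<bar> < \<eta> \<and> W = slope_line t" by blast
  qed
qed

section \<open>Lacunary patches\<close>

text \<open>\<open>Kg_le\<close> keeps each progression within length 1. \<open>K_le_M\<close>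
  bounds the size of a patch whose \<open>M q\<close> is bounded. In \<open>Mg_ge\<close>, 96 is 8
  times 12: one multiplication by \<open>M q\<close> leaps over the window from
  \<open>g q / 8\<close> to 12. In \<open>c_gap\<close>, \<open>1 + M q ^ K q\<close> bounds how far
  a patch reaches from \<open>c q\<close> for slopes in [0, 1], and 4 is the space left between
  patches.\<close>

locale lacunary_patches =
  fixes K :: "nat \<Rightarrow> nat" and g M \<tau> c :: "nat \<Rightarrow> real"
  assumes K_pos: "0 < K q" and g_pos: "0 < g q"
    and Kg_le: "real (K q) * g q \<le> 1"
    and K_le_M: "real (K q) \<le> M q" and M_ge_2: "2 \<le> M q" and Mg_ge: "96 \<le> M q * g q"
    and \<tau>_bounds: "0 < \<tau> q" "\<tau> q < 1"
    and c_gap: "q < q' \<Longrightarrow> c q + (1 + M q ^ K q) + (1 + M q' ^ K q') + 4 \<le> c q'"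
begin

text \<open>At \<open>t = 0\<close> this is the first coordinate of a point; adding \<open>t\<close>
  times the height \<open>M q ^ i\<close> gives the unscaled projection.\<close>

definition z :: "real \<Rightarrow> nat \<Rightarrow> nat \<Rightarrow> real" where
  "z t q i = c q + g q * real i + (t - \<tau> q) * M q ^ i"

definition points :: "(real^2) set" where
  "points = {vector [z 0 q i, M q ^ i] | q i. i < K q}"

definition shadow :: "real \<Rightarrow> real \<Rightarrow> real set" where
  "shadow \<mu> t = {\<mu> * z t q i | q i. i < K q}"

lemma image_points_eq_shadow:
  assumes "\<And>x. h x = \<mu> * (x $ 1 + t * x $ 2)"
  shows "h ` points = shadow \<mu> t"
proof -
  have h: "h (vector [z 0 q i, M q ^ i]) = \<mu> * z t q i" for q i
    by (simp add: assms z_def algebra_simps)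
  show ?thesis
  proof (intro equalityI subsetI)
    fix y assume "y \<in> h ` points"
    then obtain q i where "i < K q" "y = h (vector [z 0 q i, M q ^ i])"
      unfolding points_def by blast
    then show "y \<in> shadow \<mu> t" unfolding shadow_def h by blast
  next
    fix y assume "y \<in> shadow \<mu> t"
    then obtain q i where i: "i < K q" "y = h (vector [z 0 q i, M q ^ i])"
      unfolding shadow_def h by blast
    then have "vector [z 0 q i, M q ^ i] \<in> points" unfolding points_def by blast
    then show "y \<in> h ` points" using i by blast
  qed
qed

section \<open>Separation of projected points, between patches and inside one patch\<close>

lemma M_power_ge_1: "1 \<le> M q ^ i"
  using M_ge_2[of q] by (intro one_le_power) simp

lemma slope_diff_le_1: "0 \<le> t \<Longrightarrow> t \<le> 1 \<Longrightarrow> \<bar>t - \<tau> q\<bar> \<le> 1"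
  using \<tau>_bounds[of q] by linarith

lemma step_le_1:
  assumes "i \<le> K q"
  shows "g q * real i \<le> 1"
proof -
  have "g q * real i \<le> g q * real (K q)" using assms g_pos[of q] by (intro mult_left_mono) auto
  then show ?thesis using Kg_le[of q] by (simp add: mult.commute)
qed

lemma z_dist_c:
  assumes "0 \<le> t" "t \<le> 1" "i < K q"
  shows "\<bar>z t q i - c q\<bar> \<le> 1 + M q ^ K q"
proof -
  have "\<bar>(t - \<tau> q) * M q ^ i\<bar> \<le> 1 * M q ^ K q"
    unfolding abs_mult using slope_diff_le_1[OF assms(1,2)] M_ge_2[of q] assms(3)
    by (intro mult_mono) (auto intro!: power_increasing)
  moreover have "0 \<le> g q * real i" "g q * real i \<le> 1"
    using g_pos[of q] step_le_1 assms(3) by (auto simp: less_imp_le)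
  ultimately show ?thesis unfolding z_def by linarith
qed

lemma z_gap_patches:
  assumes "0 \<le> t" "t \<le> 1" "i < K q" "i' < K q'" "q \<noteq> q'"
  shows "4 \<le> \<bar>z t q i - z t q' i'\<bar>"
proof -
  have *: "c q + (1 + M q ^ K q) + (1 + M q' ^ K q') + 4 \<le> c q' \<or>
     c q' + (1 + M q' ^ K q') + (1 + M q ^ K q) + 4 \<le> c q"
    using c_gap[of q q'] c_gap[of q' q] assms(5) by (meson nat_neq_iff)
  show ?thesis using * z_dist_c[OF assms(1-3)] z_dist_c[OF assms(1,2,4)] by linarith
qed

text \<open>As \<open>M q \<ge> 2\<close>, the larger height is at least twice the smaller, so the
  tilt separates the two points by at least 6, and the progression takes back at most 1. After
  scaling by \<open>\<bar>\<mu>\<bar> \<ge> 1/2\<close>, a gap of 4 still exceeds the diameter of a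
  ball of radius less than 1.\<close>

lemma z_gap_far:
  assumes "i < i'" "i' < K q" "12 \<le> \<bar>t - \<tau> q\<bar> * M q ^ i'"
  shows "4 \<le> \<bar>z t q i - z t q i'\<bar>"
proof -
  have "M q ^ i * 2 \<le> M q ^ i * M q" using M_ge_2[of q] M_power_ge_1[of q i] by (intro mult_left_mono) auto
  also have "\<dots> = M q ^ Suc i" by simp
  also have "\<dots> \<le> M q ^ i'" using assms(1) M_ge_2[of q] by (intro power_increasing) auto
  finally have "2 * (M q ^ i' - M q ^ i) \<ge> M q ^ i'" by simp
  then have "\<bar>t - \<tau> q\<bar> * M q ^ i' \<le> \<bar>t - \<tau> q\<bar> * (2 * (M q ^ i' - M q ^ i))"
    by (intro mult_left_mono) auto
  moreover have "M q ^ i \<le> M q ^ i'" using assms(1) M_ge_2[of q] by (intro power_increasing) auto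
  ultimately have "6 \<le> \<bar>(t - \<tau> q) * (M q ^ i' - M q ^ i)\<bar>"
    using assms(3) by (simp add: abs_mult) (simp add: algebra_simps)
  moreover have "0 \<le> g q * real i" "g q * real i \<le> 1" "0 \<le> g q * real i'" "g q * real i' \<le> 1"
    using g_pos[of q] step_le_1 assms by (auto simp: less_imp_le)
  moreover have "z t q i' - z t q i = g q * real i' - g q * real i + (t - \<tau> q) * (M q ^ i' - M q ^ i)"
    by (simp add: z_def algebra_simps)
  ultimately show ?thesis by linarith
qed

text \<open>Different patches are separated in the first coordinate, which is the case
  \<open>t = 0\<close> of \<open>z_gap_patches\<close>; points of one patch are separated by their
  heights.\<close>

lemma uniform_discrete_points: "uniform_discrete points"
  unfolding uniform_discrete_def
proof (intro exI[of _ 1] conjI ballI impI)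
  fix x y assume "x \<in> points" "y \<in> points" and xy: "dist x y < 1"
  then obtain q i q' i' where x: "x = vector [z 0 q i, M q ^ i]" "i < K q"
    and y: "y = vector [z 0 q' i', M q' ^ i']" "i' < K q'"
    unfolding points_def by blast
  have "\<bar>(x - y) $ k\<bar> < 1" for k
    using component_le_norm_cart[of "x - y" k] xy by (simp add: dist_norm)
  from this[of 1] this[of 2] have d: "\<bar>z 0 q i - z 0 q' i'\<bar> < 1" "\<bar>M q ^ i - M q' ^ i'\<bar> < 1"
    using x y by simp_all
  have [simp]: "q = q'" using z_gap_patches[of 0 i q i' q'] d(1) x y by fastforce
  have sep: "1 \<le> M q ^ b - M q ^ a" if "a < b" for a b
  proof -
    have "M q ^ a * 2 \<le> M q ^ a * M q" using M_ge_2[of q] M_power_ge_1[of q a] by (intro mult_left_mono) auto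
    also have "\<dots> = M q ^ Suc a" by simp
    also have "\<dots> \<le> M q ^ b" using that M_ge_2[of q] by (intro power_increasing) auto
    finally show ?thesis using M_power_ge_1[of q a] by simp
  qed
  have "i = i'" using sep[of i i'] sep[of i' i] d(2) by (cases i i' rule: linorder_cases) auto
  then show "x = y" using x y by simp
qed simp

lemma unbounded_points: "\<not> bounded points"
proof
  assume "bounded points"
  then obtain B where B: "\<And>x. x \<in> points \<Longrightarrow> norm x \<le> B" by (auto simp: bounded_iff)
  have c_ge: "c 0 + 4 * real q \<le> c q" for q
  proof (induction q)
    case (Suc q)
    then show ?case using c_gap[of q "Suc q"] M_power_ge_1[of q "K q"] M_power_ge_1[of "Suc q" "K (Suc q)"]
      by simp
  qed simp
  obtain q where q: "B + 1 - c 0 < real q" using reals_Archimedean2 by blast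
  have "vector [z 0 q 0, M q ^ 0] \<in> points" unfolding points_def using K_pos by blast
  from B[OF this] have "z 0 q 0 \<le> B"
    using component_le_norm_cart[of "vector [z 0 q 0, M q ^ 0] :: real^2" 1] by simp
  then show False using c_ge[of q] q \<tau>_bounds[of q] by (simp add: z_def)
qed

section \<open>Covering numbers of the part of a patch seen by a small ball\<close>

lemma shadow_cball_subset_patch:
  assumes "0 \<le> t" "t \<le> 1" "1/2 \<le> \<bar>\<mu>\<bar>" "R < 1" "i0 < K q"
  shows "shadow \<mu> t \<inter> cball (\<mu> * z t q i0) R \<subseteq> (\<lambda>i. \<mu> * z t q i) ` {..<K q}"
proof
  fix y assume "y \<in> shadow \<mu> t \<inter> cball (\<mu> * z t q i0) R"
  then obtain q' i where y: "y = \<mu> * z t q' i" "i < K q'" and d: "\<bar>\<mu> * z t q i0 - y\<bar> \<le> R"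
    by (auto simp: shadow_def dist_real_def)
  have "\<bar>\<mu> * z t q i0 - y\<bar> = \<bar>\<mu>\<bar> * \<bar>z t q i0 - z t q' i\<bar>"
    unfolding y by (simp add: right_diff_distrib flip: abs_mult)
  \<comment> \<open>A point of another patch would be at distance at least 2 from the centre, which
    itself belongs to patch \<open>q\<close>.\<close>
  moreover have "q' \<noteq> q \<Longrightarrow> 1/2 * 4 \<le> \<bar>\<mu>\<bar> * \<bar>z t q i0 - z t q' i\<bar>"
    using z_gap_patches[OF assms(1,2,5) y(2)] assms(3) by (intro mult_mono) auto
  ultimately have "q' = q" using d assms(4) by linarith
  then show "y \<in> (\<lambda>i. \<mu> * z t q i) ` {..<K q}" using y by blast
qed

lemma covering_number_patch_le_card:
  assumes "0 \<le> t" "t \<le> 1" "1/2 \<le> \<bar>\<mu>\<bar>" "R < 1" "i0 < K q" "0 < r"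
  shows "covering_number r (shadow \<mu> t \<inter> cball (\<mu> * z t q i0) R) \<le> K q"
proof -
  let ?P = "(\<lambda>i. \<mu> * z t q i) ` {..<K q}"
  have "covering_number r (shadow \<mu> t \<inter> cball (\<mu> * z t q i0) R) \<le> covering_number r ?P"
    using shadow_cball_subset_patch[OF assms(1-5)] assms(6)
    by (intro covering_number_mono) (auto simp: finite_imp_bounded)
  also have "\<dots> \<le> card ?P" using assms(6) by (intro covering_number_le_card) auto
  also have "\<dots> \<le> K q" using card_image_le[of "{..<K q}" "\<lambda>i. \<mu> * z t q i"] by simp
  finally show ?thesis .
qed

text \<open>Any two far points are at least 2 apart by \<open>z_gap_far\<close>, and the ball has
  diameter less than 2.\<close>

lemma card_far_le_1:
  assumes "1/2 \<le> \<bar>\<mu>\<bar>" "R < 1"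
  shows "card {y \<in> cball x R. \<exists>i<K q. 12 \<le> \<bar>t - \<tau> q\<bar> * M q ^ i \<and> y = \<mu> * z t q i} \<le> 1"
    (is "card ?F \<le> 1")
proof -
  have "y = y'" if yy: "y \<in> ?F" "y' \<in> ?F" for y y'
  proof -
    obtain i i' where i: "i < K q" "12 \<le> \<bar>t - \<tau> q\<bar> * M q ^ i" "y = \<mu> * z t q i"
      and i': "i' < K q" "12 \<le> \<bar>t - \<tau> q\<bar> * M q ^ i'" "y' = \<mu> * z t q i'" using yy by blast
    have "\<bar>x - y\<bar> \<le> R" "\<bar>x - y'\<bar> \<le> R" using yy by (auto simp: dist_real_def)
    then have "\<bar>y - y'\<bar> < 2" using assms(2) by linarith
    moreover have "\<bar>y - y'\<bar> = \<bar>\<mu>\<bar> * \<bar>z t q i - z t q i'\<bar>"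
      unfolding i i' by (simp add: right_diff_distrib flip: abs_mult)
    moreover have "i \<noteq> i' \<Longrightarrow> 1/2 * 4 \<le> \<bar>\<mu>\<bar> * \<bar>z t q i - z t q i'\<bar>"
      using z_gap_far[of i i' q t] z_gap_far[of i' i q t] i i' assms(1)
      by (intro mult_mono) (auto simp: abs_minus_commute linorder_neq_iff)
    ultimately have "i = i'" by linarith
    then show ?thesis using i i' by simp
  qed
  moreover have "finite ?F" by (rule finite_subset[of _ "(\<lambda>i. \<mu> * z t q i) ` {..<K q}"]) auto
  ultimately show ?thesis unfolding One_nat_def by (subst card_le_Suc0_iff_eq) blast+
qed

text \<open>If the tilt already reaches 12 at height \<open>M q\<close>, every index except 0 is
  far; so the ball sees at most the point of index 0 and one far point.\<close>

lemma covering_number_patch_far: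
  assumes "0 \<le> t" "t \<le> 1" "1/2 \<le> \<bar>\<mu>\<bar>" "R < 1" "i0 < K q" "0 < r"
    and far: "12 \<le> \<bar>t - \<tau> q\<bar> * M q"
  shows "covering_number r (shadow \<mu> t \<inter> cball (\<mu> * z t q i0) R) \<le> 2"
proof -
  let ?x = "\<mu> * z t q i0"
  define F where "F = {y \<in> cball ?x R. \<exists>i<K q. 12 \<le> \<bar>t - \<tau> q\<bar> * M q ^ i \<and> y = \<mu> * z t q i}"
  have far_i: "12 \<le> \<bar>t - \<tau> q\<bar> * M q ^ i" if "i \<noteq> 0" for i
  proof -
    have "M q ^ 1 \<le> M q ^ i" using that M_ge_2[of q] by (intro power_increasing) auto
    then have "\<bar>t - \<tau> q\<bar> * M q \<le> \<bar>t - \<tau> q\<bar> * M q ^ i" by (intro mult_left_mono) auto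
    then show ?thesis using far by linarith
  qed
  have "shadow \<mu> t \<inter> cball ?x R \<subseteq> insert (\<mu> * z t q 0) F"
  proof
    fix y assume y: "y \<in> shadow \<mu> t \<inter> cball ?x R"
    then obtain i where i: "i < K q" "y = \<mu> * z t q i"
      using shadow_cball_subset_patch[OF assms(1-5)] by blast
    show "y \<in> insert (\<mu> * z t q 0) F"
    proof (cases "i = 0")
      case False
      then show ?thesis using far_i i y unfolding F_def by blast
    qed (use i in simp)
  qed
  moreover have fin: "finite F"
    unfolding F_def by (rule finite_subset[of _ "(\<lambda>i. \<mu> * z t q i) ` {..<K q}"]) auto
  ultimately have "covering_number r (shadow \<mu> t \<inter> cball ?x R) \<le> covering_number r (insert (\<mu> * z t q 0) F)"
    using assms(6) by (intro covering_number_mono) (auto simp: finite_imp_bounded)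
  also have "\<dots> \<le> card (insert (\<mu> * z t q 0) F)"
    using fin assms(6) by (intro covering_number_le_card) auto
  also have "\<dots> \<le> 2"
    using card_insert_le_m1[of 2 F] card_far_le_1[OF assms(3,4)] unfolding F_def by simp
  finally show ?thesis .
qed

text \<open>The points with tilt at most \<open>g q / 8\<close> stay within \<open>K q * g q\<close>
  of \<open>c q\<close> and are covered at the cost of a ball of that radius. At most one
  transitional and one far point remain, whence 3 = 1 + 2.\<close>

lemma covering_number_patch_le_length:
  assumes "0 \<le> t" "t \<le> 1" "1/2 \<le> \<bar>\<mu>\<bar>" "\<bar>\<mu>\<bar> \<le> 1" "R < 1" "i0 < K q" "0 < r"
  shows "real (covering_number r (shadow \<mu> t \<inter> cball (\<mu> * z t q i0) R)) \<le> 2 * (real (K q) * g q) / r + 3"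
proof -
  let ?x = "\<mu> * z t q i0" and ?e = "\<lambda>i. \<bar>t - \<tau> q\<bar> * M q ^ i"
  define F where "F = {y \<in> cball ?x R. \<exists>i<K q. 12 \<le> ?e i \<and> y = \<mu> * z t q i}"
  \<comment> \<open>The transitional indices; there is at most one because \<open>M q * g q \<ge> 96\<close>.\<close>
  define D where "D = {i. i < K q \<and> g q / 8 < ?e i \<and> ?e i < 12}"
  let ?m = "\<lambda>i. \<mu> * z t q i" and ?J = "cball (\<mu> * c q) (real (K q) * g q)"
  have "i = i'" if ii: "i \<in> D" "i' \<in> D" for i i'
  proof -
    have no: False if "a \<in> D" "b \<in> D" "a < b" for a b
    proof -
      have "g q / 8 * M q \<le> ?e a * M q"
        using that M_ge_2[of q] unfolding D_def by (intro mult_right_mono) auto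
      also have "\<dots> = \<bar>t - \<tau> q\<bar> * M q ^ Suc a" by simp
      also have "\<dots> \<le> ?e b" using that M_ge_2[of q] by (intro mult_left_mono power_increasing) auto
      also have "\<dots> < 12" using that by (simp add: D_def)
      finally show False using Mg_ge[of q] by (simp add: mult.commute)
    qed
    show ?thesis using no[of i i'] no[of i' i] ii by (cases i i' rule: linorder_cases) auto
  qed
  moreover have finD: "finite D" unfolding D_def by simp
  ultimately have D1: "card D \<le> 1" unfolding One_nat_def by (subst card_le_Suc0_iff_eq) blast+
  have F1: "card F \<le> 1" unfolding F_def by (rule card_far_le_1[OF assms(3,5)])
  have finF: "finite F"
    unfolding F_def by (rule finite_subset[of _ "?m ` {..<K q}"]) auto
  have near: "?m i \<in> ?J" if "i < K q" "?e i \<le> g q / 8" for i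
  proof -
    have "g q * (real i + 1) \<le> g q * real (K q)" using that g_pos[of q] by (intro mult_left_mono) auto
    then have "g q * real i + g q \<le> real (K q) * g q" by (simp add: algebra_simps)
    moreover have "\<bar>(t - \<tau> q) * M q ^ i\<bar> \<le> g q / 8"
      using that M_power_ge_1[of q i] by (simp add: abs_mult)
    moreover have "0 \<le> g q * real i" using g_pos[of q] by (simp add: less_imp_le)
    ultimately have "\<bar>c q - z t q i\<bar> \<le> real (K q) * g q" unfolding z_def using g_pos[of q] by linarith
    then have "\<bar>\<mu>\<bar> * \<bar>c q - z t q i\<bar> \<le> 1 * (real (K q) * g q)"
      using assms(4) by (intro mult_mono) auto
    then show ?thesis by (simp add: dist_real_def right_diff_distrib flip: abs_mult)
  qed
  have "shadow \<mu> t \<inter> cball ?x R \<subseteq> ?J \<union> (?m ` D \<union> F)"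
  proof
    fix y assume y: "y \<in> shadow \<mu> t \<inter> cball ?x R"
    then obtain i where i: "i < K q" "y = ?m i"
      using shadow_cball_subset_patch[OF assms(1-3,5,6)] by blast
    consider "?e i \<le> g q / 8" | "i \<in> D" | "12 \<le> ?e i" using i(1) unfolding D_def by fastforce
    then show "y \<in> ?J \<union> (?m ` D \<union> F)"
    proof cases
      case 1 then show ?thesis using near i by blast
    next
      case 2 then show ?thesis using i by blast
    next
      case 3 then show ?thesis using i y unfolding F_def by blast
    qed
  qed
  then have "covering_number r (shadow \<mu> t \<inter> cball ?x R) \<le> covering_number r (?J \<union> (?m ` D \<union> F))"
    using assms(7) finD finF by (intro covering_number_mono) (auto simp: finite_imp_bounded)
  also have "\<dots> \<le> covering_number r ?J + covering_number r (?m ` D \<union> F)"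
    using assms(7) finD finF by (intro covering_number_Un_le) (auto simp: finite_imp_bounded)
  also have "covering_number r (?m ` D \<union> F) \<le> card (?m ` D \<union> F)"
    using assms(7) finD finF by (intro covering_number_le_card) auto
  also have "card (?m ` D \<union> F) \<le> card (?m ` D) + card F" by (rule card_Un_le)
  also have "card (?m ` D) \<le> 1" using card_image_le[OF finD, of ?m] D1 by linarith
  also note F1
  finally have "real (covering_number r (shadow \<mu> t \<inter> cball ?x R)) \<le> real (covering_number r ?J) + 2"
    by simp
  also have "real (covering_number r ?J) \<le> 2 * (real (K q) * g q) / r + 1"
    using assms(7) g_pos[of q] by (intro covering_number_cball_real_le) auto
  finally show ?thesis by simp
qed

text \<open>Every eighth point is sampled. Neighbouring samples are \<open>8 * g q\<close> apart up
  to two errors of \<open>g q / 8\<close>, hence at least \<open>6 * g q\<close>; scaling by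
  \<open>\<mu>\<close> leaves \<open>3 * g q\<close>, more than two radii.\<close>

lemma covering_number_patch_ge:
  assumes "0 \<le> t" "t \<le> 1" "1/2 \<le> \<bar>\<mu>\<bar>" "\<bar>\<mu>\<bar> \<le> 1"
    and near: "\<bar>t - \<tau> q\<bar> * M q ^ K q \<le> g q / 8"
    and K: "K q = 8 * N" and R: "real (K q) * g q \<le> R"
  shows "N \<le> covering_number (g q) (shadow \<mu> t \<inter> cball (\<mu> * z t q 0) R)"
proof -
  let ?f = "\<lambda>l. \<mu> * z t q (8 * l)"
  have err: "\<bar>(t - \<tau> q) * M q ^ i\<bar> \<le> g q / 8" if "i < K q" for i
  proof -
    have "M q ^ i \<le> M q ^ K q" using that M_ge_2[of q] by (intro power_increasing) auto
    then have "\<bar>t - \<tau> q\<bar> * M q ^ i \<le> \<bar>t - \<tau> q\<bar> * M q ^ K q" by (intro mult_left_mono) auto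
    then show ?thesis using near M_power_ge_1[of q i] by (simp add: abs_mult)
  qed
  have sep: "2 * g q < \<bar>?f l - ?f l'\<bar>" if "l < l'" "l' < N" for l l'
  proof -
    have "g q * (8 * real l + 8) \<le> g q * (8 * real l')" using that g_pos[of q] by (intro mult_left_mono) auto
    then have "g q * real (8 * l) + 8 * g q \<le> g q * real (8 * l')" by (simp add: algebra_simps)
    then have "6 * g q \<le> \<bar>z t q (8 * l) - z t q (8 * l')\<bar>"
      using err[of "8 * l"] err[of "8 * l'"] that K g_pos[of q] unfolding z_def by linarith
    then have "1/2 * (6 * g q) \<le> \<bar>\<mu>\<bar> * \<bar>z t q (8 * l) - z t q (8 * l')\<bar>"
      using assms(3) g_pos[of q] by (intro mult_mono) auto
    then show ?thesis using g_pos[of q] by (simp add: right_diff_distrib flip: abs_mult)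
  qed
  have sep': "2 * g q < \<bar>?f l - ?f l'\<bar>" if "l \<noteq> l'" "l < N" "l' < N" for l l'
    using that sep[of l l'] sep[of l' l] abs_minus_commute[of "?f l" "?f l'"]
    by (cases l l' rule: linorder_cases) simp_all
  have inj: "inj_on ?f {..<N}"
  proof (rule inj_onI, rule ccontr)
    fix l l' assume "l \<in> {..<N}" "l' \<in> {..<N}" "?f l = ?f l'" "l \<noteq> l'"
    then have "2 * g q < \<bar>?f l - ?f l'\<bar>" "?f l - ?f l' = 0" using sep' by simp_all
    then show False using g_pos[of q] by linarith
  qed
  have "card (?f ` {..<N}) \<le> covering_number (g q) (shadow \<mu> t \<inter> cball (\<mu> * z t q 0) R)"
  proof (rule card_separated_le_covering_number)
    show "bounded (shadow \<mu> t \<inter> cball (\<mu> * z t q 0) R)" by (simp add: bounded_Int)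
    show "0 < g q" by (rule g_pos)
    show "?f ` {..<N} \<subseteq> shadow \<mu> t \<inter> cball (\<mu> * z t q 0) R"
    proof (intro subsetI, elim imageE)
      fix y l assume l: "l \<in> {..<N}" and y: "y = ?f l"
      \<comment> \<open>The spare gap \<open>g q\<close> after the sampled index absorbs the two
        tilt errors, so the sample stays within the length of the progression.\<close>
      have "g q * (real (8 * l) + 1) \<le> g q * real (K q)" using l K g_pos[of q] by (intro mult_left_mono) auto
      then have "g q * real (8 * l) + g q \<le> real (K q) * g q" by (simp add: algebra_simps)
      moreover have "0 \<le> g q * real (8 * l)" using g_pos[of q] by (simp add: less_imp_le)
      moreover have "\<bar>(t - \<tau> q) * M q ^ (8 * l)\<bar> \<le> g q / 8" "\<bar>(t - \<tau> q) * M q ^ 0\<bar> \<le> g q / 8"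
        using err[of "8 * l"] err[of 0] l K K_pos[of q] by simp_all
      moreover have "g q * real 0 = 0" by simp
      ultimately have "\<bar>z t q 0 - z t q (8 * l)\<bar> \<le> R"
        using R g_pos[of q] unfolding z_def by linarith
      then have "\<bar>\<mu>\<bar> * \<bar>z t q 0 - z t q (8 * l)\<bar> \<le> 1 * R"
        using assms(4) by (intro mult_mono) auto
      then have "y \<in> cball (\<mu> * z t q 0) R"
        unfolding y by (simp add: dist_real_def right_diff_distrib flip: abs_mult)
      moreover have "8 * l < K q" using l K by simp
      then have "y \<in> shadow \<mu> t" unfolding y shadow_def by blast
      ultimately show "y \<in> shadow \<mu> t \<inter> cball (\<mu> * z t q 0) R" by blast
    qed
    fix x y assume xy: "x \<in> ?f ` {..<N}" "y \<in> ?f ` {..<N}" "x \<noteq> y"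
    then obtain l l' where l: "l < N" "l' < N" "x = ?f l" "y = ?f l'" by blast
    then have "l \<noteq> l'" using xy(3) by blast
    then show "2 * g q < dist x y" unfolding dist_real_def l(3,4) using l(1,2) by (rule sep')
  qed
  then show ?thesis using card_image[OF inj] by simp
qed

end

section \<open>The Assouad spectrum of the projections\<close>

lemma ratio_powr:
  fixes R :: real
  assumes "0 < R"
  shows "(R / R powr (1 / \<theta>)) powr \<alpha> = R powr ((1 - 1 / \<theta>) * \<alpha>)"
proof -
  have "R / R powr (1 / \<theta>) = R powr (1 - 1 / \<theta>)" using assms by (simp add: powr_diff)
  then show ?thesis by (simp add: powr_powr)
qed

lemma one_le_ratio_powr:
  fixes R :: real
  assumes "0 < R" "R < 1" "0 < \<theta>" "\<theta> < 1" "0 \<le> \<alpha>"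
  shows "1 \<le> (R / R powr (1 / \<theta>)) powr \<alpha>"
proof -
  have "(1 - 1 / \<theta>) * \<alpha> \<le> 0" using assms by (intro mult_nonpos_nonneg) (auto simp: field_simps)
  then have "R powr 0 \<le> R powr ((1 - 1 / \<theta>) * \<alpha>)" using assms by (intro powr_mono') auto
  then show ?thesis using assms by (simp add: ratio_powr)
qed

text \<open>The regimes meet at \<open>R = g powr \<theta>\<close>, that is \<open>r = g\<close>,
  where \<open>(R / r) powr s\<close> equals \<open>k\<close>. For smaller \<open>R\<close> the
  ratio is larger, so counting points suffices. For larger \<open>R\<close>, \<open>k * g\<close> is
  a nonnegative power of \<open>g \<le> r\<close>, and the same power of \<open>r\<close> divided by
  \<open>r\<close> is exactly \<open>(R / r) powr s\<close>.\<close>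

lemma patch_count_le_ratio:
  fixes g R s \<theta> :: real
  assumes "0 < \<theta>" "\<theta> < 1" "0 < s" "s \<le> 1" "0 < g" "0 < R"
  defines "k \<equiv> g powr (-(s * (1 - \<theta>)))" and "r \<equiv> R powr (1 / \<theta>)"
  shows "k \<le> (R / r) powr s \<or> k * g / r \<le> (R / r) powr s"
proof (cases "R \<le> g powr \<theta>")
  case True
  have e: "(1 - 1 / \<theta>) * s \<le> 0" using assms(1-3) by (intro mult_nonpos_nonneg) (auto simp: field_simps)
  have "k = (g powr \<theta>) powr ((1 - 1 / \<theta>) * s)"
    unfolding k_def using assms(1) by (simp add: powr_powr algebra_simps)
  also have "\<dots> \<le> R powr ((1 - 1 / \<theta>) * s)" using True assms(6) e by (intro powr_mono2') auto
  finally show ?thesis using assms(6) by (simp add: r_def ratio_powr)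
next
  case False
  let ?e = "1 - s * (1 - \<theta>)"
  have e: "0 \<le> ?e" using mult_mono[of s 1 "1 - \<theta>" 1] assms(1-4) by simp
  have "g = (g powr \<theta>) powr (1 / \<theta>)" using assms(1,5) by (simp add: powr_powr)
  also have "\<dots> \<le> r" unfolding r_def using False assms(1) by (intro powr_mono2) auto
  finally have "g \<le> r" .
  have r: "0 < r" using assms(6) by (simp add: r_def)
  have "k * g = g powr ?e"
    unfolding k_def using assms(5) by (simp add: powr_diff powr_minus divide_inverse mult.commute)
  also have "\<dots> \<le> r powr ?e" using \<open>g \<le> r\<close> assms(5) e by (intro powr_mono2) auto
  finally have "k * g / r \<le> r powr ?e / r" using r by (intro divide_right_mono) auto
  also have "\<dots> = r powr (- (s * (1 - \<theta>)))"
    using r by (simp add: powr_diff powr_minus divide_inverse mult.commute)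
  also have "\<dots> = (R / r) powr s"
    using assms(1,6) unfolding r_def by (simp add: ratio_powr powr_powr field_simps)
  finally show ?thesis by simp
qed

context lacunary_patches
begin

text \<open>\<open>A\<close> collects the patches built for the value \<open>s\<close>;
  \<open>near\<close> supplies arbitrarily large ones that the line meets almost exactly. The upper
  bound treats all scales, while the lower bound tests only
  \<open>R = g q powr \<theta>\<close>.\<close>

lemma assouad_spectrum_shadow:
  assumes \<theta>: "0 < \<theta>" "\<theta> < 1" and s: "0 < s" "s \<le> 1" and t: "0 \<le> t" "t \<le> 1"
    and \<mu>: "1/2 \<le> \<bar>\<mu>\<bar>" "\<bar>\<mu>\<bar> \<le> 1" and d: "0 < d"
    and own: "\<And>q. q \<in> A \<Longrightarrow> real (K q) = g q powr (-(s * (1 - \<theta>)))"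
    and other: "\<And>q. q \<notin> A \<Longrightarrow> d \<le> \<bar>t - \<tau> q\<bar>"
    and near: "\<And>n. \<exists>q\<in>A. \<exists>N\<ge>n. K q = 8 * N \<and> \<bar>t - \<tau> q\<bar> * M q ^ K q \<le> g q / 8"
  shows "assouad_spectrum \<theta> (shadow \<mu> t) = s"
  unfolding assouad_spectrum_def
proof (rule cInf_eq_minimum)
  let ?Y = "shadow \<mu> t"
  have upper: "real (covering_number (R powr (1 / \<theta>)) (?Y \<inter> cball x R))
      \<le> (5 + 12 / d) * (R / R powr (1 / \<theta>)) powr s" if R: "0 < R" "R < 1" and x: "x \<in> ?Y" for R x
  proof -
    define r where "r = R powr (1 / \<theta>)"
    define P where "P = (R / r) powr s"
    have r: "0 < r" using R by (simp add: r_def)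
    have P1: "1 \<le> P" unfolding P_def r_def using R \<theta> s by (intro one_le_ratio_powr) auto
    have dP: "0 \<le> 12 / d * P" using d P1 by simp
    obtain q i where x: "x = \<mu> * z t q i" "i < K q" using x unfolding shadow_def by blast
    let ?N = "covering_number r (?Y \<inter> cball x R)"
    have card: "real ?N \<le> real (K q)"
      using covering_number_patch_le_card[OF t \<mu>(1) R(2) x(2) r] x(1) by simp
    \<comment> \<open>As \<open>P \<ge> 1\<close>, the 5 absorbs the length bound
      \<open>2 * P + 3\<close> for patches in \<open>A\<close> and the bound 2 for far ones. A patch
      outside \<open>A\<close> that is not far has
      \<open>K q \<le> M q \<le> 12 / d\<close>.\<close>
    have "real ?N \<le> 5 * P + 12 / d * P"
    proof (cases "q \<in> A")
      case True
      have len: "real ?N \<le> 2 * (real (K q) * g q / r) + 3"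
        using covering_number_patch_le_length[OF t \<mu> R(2) x(2) r] x(1) by simp
      have "real (K q) \<le> P \<or> real (K q) * g q / r \<le> P"
        using patch_count_le_ratio[OF \<theta> s g_pos[of q] R(1)]
        unfolding own[OF True] P_def r_def .
      then show ?thesis using card len P1 dP by linarith
    next
      case False
      show ?thesis
      proof (cases "12 \<le> \<bar>t - \<tau> q\<bar> * M q")
        case True
        then have "?N \<le> 2"
          using covering_number_patch_far[OF t \<mu>(1) R(2) x(2) r] x(1) by simp
        then show ?thesis using P1 dP by linarith
      next
        case far: False
        have "d * M q \<le> \<bar>t - \<tau> q\<bar> * M q"
          using other[OF False] M_ge_2[of q] by (intro mult_right_mono) auto
        then have "M q \<le> 12 / d" using far d by (simp add: field_simps)
        then have "real ?N \<le> 12 / d * 1" using card K_le_M[of q] by linarith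
        also have "\<dots> \<le> 12 / d * P" using P1 d by (intro mult_left_mono) auto
        finally show ?thesis using P1 by linarith
      qed
    qed
    then show ?thesis unfolding P_def r_def by (simp add: distrib_right)
  qed
  show "s \<in> {\<alpha>. 0 \<le> \<alpha> \<and> (\<exists>C>0. \<forall>R x. 0 < R \<and> R < 1 \<and> x \<in> ?Y \<longrightarrow>
      real (covering_number (R powr (1 / \<theta>)) (?Y \<inter> cball x R)) \<le> C * (R / R powr (1 / \<theta>)) powr \<alpha>)}"
    using s d upper by (auto intro!: exI[of _ "5 + 12 / d"] add_pos_pos)
  fix \<alpha>
  assume "\<alpha> \<in> {\<alpha>. 0 \<le> \<alpha> \<and> (\<exists>C>0. \<forall>R x. 0 < R \<and> R < 1 \<and> x \<in> ?Y \<longrightarrow>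
      real (covering_number (R powr (1 / \<theta>)) (?Y \<inter> cball x R)) \<le> C * (R / R powr (1 / \<theta>)) powr \<alpha>)}"
  then obtain C where \<alpha>: "0 \<le> \<alpha>" and C: "0 < C"
    and bound: "\<And>R x. 0 < R \<Longrightarrow> R < 1 \<Longrightarrow> x \<in> ?Y \<Longrightarrow>
      real (covering_number (R powr (1 / \<theta>)) (?Y \<inter> cball x R)) \<le> C * (R / R powr (1 / \<theta>)) powr \<alpha>"
    by blast
  show "s \<le> \<alpha>"
  proof (rule ccontr)
    assume "\<not> s \<le> \<alpha>"
    \<comment> \<open>At the tested scale \<open>(R / r) powr \<alpha>\<close> is
      \<open>K q powr \<beta>\<close>. The assumed bound then reads
      \<open>N \<le> 8 * C * N powr \<beta>\<close> with \<open>\<beta> < 1\<close>, and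
      \<open>n\<close> is chosen to violate it.\<close>
    define \<beta> where "\<beta> = \<alpha> / s"
    have \<beta>: "0 \<le> \<beta>" "\<beta> < 1" using \<alpha> s \<open>\<not> s \<le> \<alpha>\<close> by (auto simp: \<beta>_def)
    obtain n :: nat where n: "(8 * C) powr (1 / (1 - \<beta>)) < real n" using reals_Archimedean2 by blast
    obtain q N where q: "q \<in> A" "N \<ge> max 1 n" "K q = 8 * N" "\<bar>t - \<tau> q\<bar> * M q ^ K q \<le> g q / 8"
      using near[of "max 1 n"] by blast
    have N1: "1 \<le> real N" using q(2) by simp
    have "8 * g q \<le> real (K q) * g q" using g_pos[of q] q(2,3) by (intro mult_right_mono) auto
    then have g1: "g q < 1" using Kg_le[of q] by linarith
    define R where "R = g q powr \<theta>"
    have R: "0 < R" "R < 1" using g_pos[of q] g1 \<theta> powr_less_mono2[of \<theta> "g q" 1] by (auto simp: R_def)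
    have r: "R powr (1 / \<theta>) = g q" using \<theta> g_pos[of q] by (simp add: R_def powr_powr)
    \<comment> \<open>The length \<open>K q * g q\<close> is a power of \<open>g q < 1\<close> with
      exponent at least \<open>\<theta>\<close>, so the whole progression fits into radius
      \<open>R\<close>.\<close>
    have "s * (1 - \<theta>) \<le> 1 * (1 - \<theta>)" using s \<theta> by (intro mult_right_mono) auto
    then have "g q powr (1 - s * (1 - \<theta>)) \<le> g q powr \<theta>"
      using g_pos[of q] g1 by (intro powr_mono') auto
    moreover have "real (K q) * g q = g q powr (1 - s * (1 - \<theta>))"
      using own[OF q(1)] g_pos[of q] by (simp add: powr_diff powr_minus divide_inverse mult.commute)
    ultimately have KR: "real (K q) * g q \<le> R" by (simp add: R_def)
    have "N \<le> covering_number (g q) (?Y \<inter> cball (\<mu> * z t q 0) R)"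
      by (rule covering_number_patch_ge[OF t \<mu> q(4,3) KR])
    then have "real N \<le> real (covering_number (R powr (1 / \<theta>)) (?Y \<inter> cball (\<mu> * z t q 0) R))"
      unfolding r by simp
    also have "\<dots> \<le> C * (R / R powr (1 / \<theta>)) powr \<alpha>"
      by (rule bound[OF R]) (use K_pos in \<open>auto simp: shadow_def\<close>)
    also have "(R / R powr (1 / \<theta>)) powr \<alpha> = real (K q) powr \<beta>"
    proof -
      have "\<theta> * ((1 - 1 / \<theta>) * \<alpha>) = - (s * (1 - \<theta>)) * \<beta>"
        unfolding \<beta>_def using \<theta> s by (simp add: field_simps)
      then show ?thesis unfolding ratio_powr[OF R(1)] own[OF q(1)] unfolding R_def powr_powr by (rule arg_cong)
    qed
    also have "real (K q) powr \<beta> = 8 powr \<beta> * real N powr \<beta>"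
      using q(3) by (simp add: powr_mult)
    also have "C * (8 powr \<beta> * real N powr \<beta>) \<le> C * (8 powr 1 * real N powr \<beta>)"
      using \<beta> C by (intro mult_left_mono mult_right_mono powr_mono) auto
    finally have "real N \<le> 8 * C * real N powr \<beta>" by simp
    moreover have "real N = real N powr (1 - \<beta>) * real N powr \<beta>"
      using N1 by (simp flip: powr_add)
    ultimately have "real N powr (1 - \<beta>) * real N powr \<beta> \<le> 8 * C * real N powr \<beta>" by simp
    then have le: "real N powr (1 - \<beta>) \<le> 8 * C" using N1 by simp
    have "8 * C = ((8 * C) powr (1 / (1 - \<beta>))) powr (1 - \<beta>)"
      using \<beta> C by (simp add: powr_powr)
    also have "\<dots> < real N powr (1 - \<beta>)"
      using \<beta> n q(2) by (intro powr_less_mono2) auto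
    finally show False using le by simp
  qed
qed

end

section \<open>Choice of the parameters\<close>

text \<open>Intervals of half-length \<open>S q + 2\<close> are laid end to end; up to a common
  shift by 2, \<open>c q\<close> is the centre of the one numbered \<open>q\<close>.\<close>

lemma exists_separated_centers:
  fixes S :: "nat \<Rightarrow> real"
  assumes "\<And>q. 0 \<le> S q"
  obtains c where "\<And>q q'. q < q' \<Longrightarrow> c q + S q + S q' + 4 \<le> c q'"
proof
  define c where "c q = S q + 2 * (\<Sum>i<q. S i + 2)" for q
  fix q q' :: nat assume "q < q'"
  then have "(\<Sum>i<Suc q. S i + 2) \<le> (\<Sum>i<q'. S i + 2)"
    using assms by (intro sum_mono2) (auto intro: add_nonneg_nonneg)
  then show "c q + S q + S q' + 4 \<le> c q'" by (simp add: c_def)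
qed

definition mid_slope :: "nat \<Rightarrow> real" where
  "mid_slope j = (1/4) ^ Suc j"

lemma mid_slope_bounds: "0 < mid_slope j" "mid_slope j \<le> 1/4"
  using power_le_one[of "1/4::real" j] by (auto simp: mid_slope_def)

text \<open>The centres decrease by a factor 4 while the radii are a quarter of the centres. The
  lower bound depends on \<open>k\<close> alone, so it is uniform over the patches of all other
  values.\<close>

lemma slopes_separated:
  assumes "\<bar>t - mid_slope k\<bar> < mid_slope k / 4" "\<bar>\<tau> - mid_slope j\<bar> < mid_slope j / 4" "j \<noteq> k"
  shows "mid_slope k / 4 \<le> \<bar>t - \<tau>\<bar>"
proof -
  have dec: "mid_slope b \<le> mid_slope a / 4" if "a < b" for a b
  proof -
    have "(1/4::real) ^ Suc b \<le> (1/4) ^ Suc (Suc a)" using that by (intro power_decreasing) auto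
    then show ?thesis by (simp add: mid_slope_def)
  qed
  show ?thesis
  proof (cases "j < k")
    case True
    then show ?thesis using dec[OF True] assms(1,2) mid_slope_bounds(1)[of k] by linarith
  next
    case False
    then have "k < j" using assms(3) by simp
    then show ?thesis using dec[of k j] assms(1,2) mid_slope_bounds(1)[of k] by linarith
  qed
qed

lemma exists_dense_sequence:
  fixes a e :: real
  assumes "0 < e"
  obtains f :: "nat \<Rightarrow> real" where "\<And>m. \<bar>f m - a\<bar> < e"
    "\<And>t \<delta>. \<bar>t - a\<bar> < e \<Longrightarrow> 0 < \<delta> \<Longrightarrow> \<exists>m. \<bar>t - f m\<bar> < \<delta>"
proof
  \<comment> \<open>An enumeration of the rationals, with those outside the interval replaced by its
    centre.\<close>
  define f :: "nat \<Rightarrow> real" where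
    "f m = (let x = of_rat (from_nat m) in if \<bar>x - a\<bar> < e then x else a)" for m
  show "\<bar>f m - a\<bar> < e" for m using assms by (auto simp: f_def Let_def)
  fix t \<delta> :: real assume t: "\<bar>t - a\<bar> < e" and \<delta>: "0 < \<delta>"
  have "max (t - \<delta>) (a - e) < min (t + \<delta>) (a + e)" using t \<delta> assms by linarith
  then obtain x :: rat where x: "max (t - \<delta>) (a - e) < of_rat x" "of_rat x < min (t + \<delta>) (a + e)"
    using of_rat_dense by blast
  have "f (to_nat x) = of_rat x" using x by (auto simp: f_def Let_def abs_if)
  then have "\<bar>t - f (to_nat x)\<bar> < \<delta>" using x by (simp add: abs_less_iff)
  then show "\<exists>m. \<bar>t - f m\<bar> < \<delta>" by blast
qed

lemma patch_count_times_step_le_1: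
  fixes k e :: real
  assumes "1 \<le> k" "0 < e" "e \<le> 1"
  shows "k * k powr (- 1 / e) \<le> 1"
proof -
  have "k * k powr (- 1 / e) = k powr (1 + (- 1 / e))" using assms by (simp only: powr_add powr_one)
  also have "\<dots> \<le> k powr 0" using assms by (intro powr_mono) (auto simp: field_simps)
  finally show ?thesis using assms by simp
qed

theorem theorem2p8:
  fixes \<theta> :: real and s :: "nat \<Rightarrow> real"
  assumes "0 < \<theta>" "\<theta> < 1"
    and "\<And>j. 0 < s j \<and> s j \<le> 1"
  shows "\<exists>(X :: (real^2) set) (I :: nat \<Rightarrow> (real^2) set set).
    uniform_discrete X \<and> \<not> bounded X \<and>
    (\<forall>j. I j \<noteq> {} \<and> openin line_topology (I j)) \<and>
    disjoint_family I \<and>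
    (\<forall>j. \<forall>V\<in>I j. \<forall>\<phi>. line_identification V \<phi> \<longrightarrow>
        assouad_spectrum \<theta> (\<phi> ` orth_proj V ` X) = s j)"
proof -
  interpret angle: Metric_space lines acute_angle by (rule Metric_space_lines)
  let ?a = mid_slope
  have "\<forall>j. \<exists>\<rho>>0. \<forall>W\<in>lines. acute_angle (slope_line (?a j)) W < \<rho> \<longrightarrow>
      (\<exists>t. \<bar>t - ?a j\<bar> < ?a j / 4 \<and> W = slope_line t)"
  proof
    fix j
    have "\<bar>?a j\<bar> \<le> 1" "0 < ?a j / 4" using mid_slope_bounds[of j] by auto
    from lines_near_slope_line[OF this]
    show "\<exists>\<rho>>0. \<forall>W\<in>lines. acute_angle (slope_line (?a j)) W < \<rho> \<longrightarrow>
      (\<exists>t. \<bar>t - ?a j\<bar> < ?a j / 4 \<and> W = slope_line t)" by metis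
  qed
  then obtain \<rho> where \<rho>: "\<And>j. 0 < \<rho> j"
    and slope: "\<And>j W. W \<in> lines \<Longrightarrow> acute_angle (slope_line (?a j)) W < \<rho> j \<Longrightarrow>
      \<exists>t. \<bar>t - ?a j\<bar> < ?a j / 4 \<and> W = slope_line t" by metis
  define I where "I j = angle.mball (slope_line (?a j)) (\<rho> j)" for j
  have I: "\<exists>t. \<bar>t - ?a j\<bar> < ?a j / 4 \<and> V = slope_line t" if "V \<in> I j" for V j
    using that slope unfolding I_def angle.in_mball by blast

  have "\<forall>j. \<exists>f :: nat \<Rightarrow> real. (\<forall>m. \<bar>f m - ?a j\<bar> < ?a j / 4) \<and>
      (\<forall>t \<delta>. \<bar>t - ?a j\<bar> < ?a j / 4 \<longrightarrow> 0 < \<delta> \<longrightarrow> (\<exists>m. \<bar>t - f m\<bar> < \<delta>))"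
  proof
    fix j
    have "0 < ?a j / 4" using mid_slope_bounds[of j] by simp
    from exists_dense_sequence[OF this, of "?a j"]
    show "\<exists>f :: nat \<Rightarrow> real. (\<forall>m. \<bar>f m - ?a j\<bar> < ?a j / 4) \<and>
      (\<forall>t \<delta>. \<bar>t - ?a j\<bar> < ?a j / 4 \<longrightarrow> 0 < \<delta> \<longrightarrow> (\<exists>m. \<bar>t - f m\<bar> < \<delta>))" by metis
  qed
  then obtain f :: "nat \<Rightarrow> nat \<Rightarrow> real" where f: "\<And>j m. \<bar>f j m - ?a j\<bar> < ?a j / 4"
    and dense: "\<And>j t \<delta>. \<bar>t - ?a j\<bar> < ?a j / 4 \<Longrightarrow> 0 < \<delta> \<Longrightarrow> \<exists>m. \<bar>t - f j m\<bar> < \<delta>" by metis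

  \<comment> \<open>A patch number codes a triple: the target value \<open>jj q\<close>, the size
    parameter \<open>nn q\<close> and the place \<open>mm q\<close> of its slope in the dense
    sequence. Thus every size occurs with every slope.\<close>
  define jj where "jj q = fst (prod_decode q)" for q
  define nn where "nn q = fst (prod_decode (snd (prod_decode q)))" for q
  define mm where "mm q = snd (prod_decode (snd (prod_decode q)))" for q
  define K :: "nat \<Rightarrow> nat" where "K q = 8 * Suc (nn q)" for q
  define e where "e q = s (jj q) * (1 - \<theta>)" for q
  \<comment> \<open>This solves \<open>K q = g q powr (- e q)\<close> for the gap; the next line
    takes \<open>M q\<close> as a sum so as to dominate both \<open>K q\<close> and
    \<open>96 / g q\<close>.\<close>
  define g where "g q = real (K q) powr (- 1 / e q)" for q
  define M where "M q = real (K q) + 96 / g q" for q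
  define \<tau> where "\<tau> q = f (jj q) (mm q)" for q
  have e: "0 < e q" "e q \<le> 1" for q
    using assms(1,2) assms(3)[of "jj q"] mult_mono[of "s (jj q)" 1 "1 - \<theta>" 1] by (auto simp: e_def)
  have K8: "8 \<le> K q" for q by (simp add: K_def)
  have g: "0 < g q" for q using K8[of q] by (simp add: g_def)
  have M: "real (K q) \<le> M q" "2 \<le> M q" "96 \<le> M q * g q" for q
    using g[of q] K8[of q] by (auto simp: M_def distrib_right intro: add_increasing2 less_imp_le)
  obtain c where c: "\<And>q q'. q < q' \<Longrightarrow> c q + (1 + M q ^ K q) + (1 + M q' ^ K q') + 4 \<le> c q'"
  proof -
    have "0 \<le> 1 + M q ^ K q" for q using M(2)[of q] by simp
    from exists_separated_centers[of "\<lambda>q. 1 + M q ^ K q", OF this] show thesis using that by blast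
  qed
  interpret lacunary_patches K g M \<tau> c
  proof
    fix q q'
    show "0 < K q" using K8[of q] by simp
    show "real (K q) * g q \<le> 1"
      unfolding g_def using K8[of q] e[of q] by (intro patch_count_times_step_le_1) auto
    show "0 < \<tau> q" "\<tau> q < 1"
      using f[of "jj q" "mm q"] mid_slope_bounds[of "jj q"] unfolding \<tau>_def by linarith+
  qed (use g M c in auto)

  show ?thesis
  proof (intro exI[of _ points] exI[of _ I] conjI allI ballI impI)
    show "uniform_discrete points" "\<not> bounded points"
      by (rule uniform_discrete_points unbounded_points)+
    fix j
    have "slope_line (?a j) \<in> I j"
      unfolding I_def angle.centre_in_mball_iff using slope_line_in_lines \<rho> by simp
    then show "I j \<noteq> {}" by blast
    show "openin line_topology (I j)" unfolding I_def line_topology_def by (rule angle.openin_mball)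
    fix V \<phi> assume V: "V \<in> I j" and \<phi>: "line_identification V \<phi>"
    obtain t where t: "\<bar>t - ?a j\<bar> < ?a j / 4" "V = slope_line t" using I[OF V] by blast
    have t01: "0 \<le> t" "t \<le> 1" using t(1) mid_slope_bounds[of j] by linarith+
    obtain \<mu> where \<mu>: "1/2 \<le> \<bar>\<mu>\<bar>" "\<bar>\<mu>\<bar> \<le> 1"
      and proj: "\<And>x. \<phi> (orth_proj V x) = \<mu> * (x $ 1 + t * x $ 2)"
      using line_identification_slope_line[OF \<phi>[unfolded t(2)] t01] unfolding t(2) by blast
    have "\<phi> ` orth_proj V ` points = shadow \<mu> t"
      unfolding image_image by (rule image_points_eq_shadow) (rule proj)
    moreover have "assouad_spectrum \<theta> (shadow \<mu> t) = s j"
    proof (rule assouad_spectrum_shadow[where d = "?a j / 4" and A = "{q. jj q = j}"])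
      show "0 < ?a j / 4" using mid_slope_bounds by simp
      show "real (K q) = g q powr (- (s j * (1 - \<theta>)))" if "q \<in> {q. jj q = j}" for q
      proof -
        have "- (s j * (1 - \<theta>)) = - e q" using that by (simp add: e_def)
        then show ?thesis unfolding g_def using e[of q] K8[of q] by (simp add: powr_powr)
      qed
      show "?a j / 4 \<le> \<bar>t - \<tau> q\<bar>" if "q \<notin> {q. jj q = j}" for q
        using slopes_separated[OF t(1) f[of "jj q" "mm q"]] that by (simp add: \<tau>_def)
      fix n
      \<comment> \<open>\<open>K\<close>, \<open>g\<close> and \<open>M\<close> do not depend on the
        last code entry, so the tolerance is read off at entry 0 before the slope index
        \<open>m\<close> is chosen.\<close>
      define q0 where "q0 = prod_encode (j, prod_encode (n, 0))"
      have "0 < g q0 / 8 / M q0 ^ K q0" using g[of q0] M(2)[of q0] by simp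
      from dense[OF t(1) this] obtain m where m: "\<bar>t - f j m\<bar> < g q0 / 8 / M q0 ^ K q0" by blast
      define q where "q = prod_encode (j, prod_encode (n, m))"
      have q: "jj q = j" "nn q = n" "mm q = m" "jj q0 = j" "nn q0 = n"
        by (simp_all add: q_def q0_def jj_def nn_def mm_def)
      have K: "K q0 = K q" by (simp add: K_def q)
      have gq: "g q0 = g q" by (simp add: g_def K e_def q)
      have Mq: "M q0 = M q" by (simp add: M_def K gq)
      have "\<bar>t - \<tau> q\<bar> * M q ^ K q \<le> g q / 8"
        using m M(2)[of q] unfolding K gq Mq \<tau>_def q by (simp add: field_simps)
      moreover have "K q = 8 * Suc n" by (simp add: K_def q)
      moreover have "Suc n \<ge> n" by simp
      ultimately show "\<exists>q\<in>{q. jj q = j}. \<exists>N\<ge>n. K q = 8 * N \<and> \<bar>t - \<tau> q\<bar> * M q ^ K q \<le> g q / 8"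
        using q(1) by blast
    qed (use assms t01 \<mu> in auto)
    ultimately show "assouad_spectrum \<theta> (\<phi> ` orth_proj V ` points) = s j" by simp
  next
    show "disjoint_family I"
      unfolding disjoint_family_on_def
    proof (intro ballI impI, rule ccontr)
      fix j k assume "j \<noteq> k" "I j \<inter> I k \<noteq> {}"
      then obtain V where "V \<in> I j" "V \<in> I k" by blast
      then obtain t t' where *: "\<bar>t - ?a j\<bar> < ?a j / 4" "\<bar>t' - ?a k\<bar> < ?a k / 4"
        "slope_line t = slope_line t'" using I by metis
      then have "t = t'" using slope_line_inj by blast
      then show False using slopes_separated[OF *(2,1) \<open>j \<noteq> k\<close>] mid_slope_bounds(1)[of k] by simp
    qed
  qed
qed

end
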